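(* Let $\mathcal E$ and $\overline{\mathcal E}$ be non-normalized seed patterns of rank $n$ on labeled $n$-regular trees $\mathbb T_n$ and $\overline{\mathbb T}_n$, with coefficient groups $\mathbf P,\overline{\mathbf P}$ and ambient semifields $\mathcal F_{>0},\overline{\mathcal F}_{>0}$, and let $t\mapsto\overline t$ be an isomorphism of labeled trees $\mathbb T_n\to\overline{\mathbb T}_n$. Suppose the seeds in $\overline{\mathcal E}$ are indecomposable. Let $\mathcal N$ be a nerve for $\mathbb T_n$. Let $\Psi:\mathcal F_{>0}\to\overline{\mathcal F}_{>0}$ be a semifield homomorphism with $\Psi(\mathbf P)\subset\overline{\mathbf P}$ such that $\Psi(x_j(t))/\overline x_j(\overline t)\in\overline{\mathbf P}$ for every vertex $t$ and label $j$ such that the edge at $t$ labeled $j$ is in $\mathcal N$. Then $\Psi$ is a quasi-homomorphism from $\mathcal E$ to $\overline{\mathcal E}$ or from $\mathcal E$ to $\overline{\mathcal E}^{\mathrm{opp}}$.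
   Context: Notation: $[x]_+=\max(x,0)$; $\mathrm{sign}(x)\in\{-1,0,1\}$. The coefficient group $\mathbf P$ is a torsion-free abelian multiplicative group, and the ambient field $\mathcal F$ is a field of rational functions in $n$ variables with coefficients in $\mathbf P$. A non-normalized seed in $\mathcal F$ is a triple $\Sigma=(B,\mathbf p,\mathbf x)$ where $B=(b_{ij})$ is a skew-symmetrizable $n\times n$ integer matrix, $\mathbf p=(p_1^{\pm},\dots,p_n^{\pm})$ consists of $2n$ elements of $\mathbf P$, and the cluster $\mathbf x=(x_1,\dots,x_n)$ is a tuple of algebraically independent elements freely generating $\mathcal F$ over $\mathbb Q\mathbf P$. Seeds $(B,\mathbf p,\mathbf x)$ and $(B',\mathbf p',\mathbf x')$ are related by a mutation in direction $k$ if: $b'_{ij}=-b_{ij}$ if $i=k$ or $j=k$, and $b'_{ij}=b_{ij}+\mathrm{sign}(b_{ik})[b_{ik}b_{kj}]_+$ otherwise; $(p')^{\pm}_k=p_k^{\mp}$, and for $j\ne k$: $(p')_j^+/(p')_j^-=(p_j^+/p_j^-)(p_k^+)^{b_{kj}}$ if $b_{kj}\ge0$, and $=(p_j^+/p_j^-)(p_k^-)^{b_{kj}}$ if $b_{kj}\le0$; $x'_j=x_j$ for $j\ne k$ and $x_kx'_k=p_k^+\prod_j x_j^{[b_{jk}]_+}+p_k^-\prod_j x_j^{[-b_{jk}]_+}$. A labeled $n$-regular tree has the edges at each vertex labeled $1,\dots,n$; isomorphisms preserve labels. A non-normalized seed pattern is a family of non-normalized seeds $\Sigma(t)=(B(t),\mathbf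 p(t),\mathbf x(t))$, $t\in\mathbb T_n$, such that seeds at vertices joined by an edge labeled $k$ are related by a mutation in direction $k$. Its ambient semifield $\mathcal F_{>0}\subset\mathcal F$ is the set of elements expressible from a cluster and elements of $\mathbf P$ using only $+,\times,\div$ (independent of the cluster). Data of the second pattern are denoted with bars. A nerve for $\mathbb T_n$ is a connected subgraph $\mathcal N$ of $\mathbb T_n$ in which every edge label $k\in\{1,\dots,n\}$ occurs at least once. A seed is indecomposable if the graph on $\{1,\dots,n\}$ with $i,j$ joined when $b_{ij}\neq0$ is connected. The opposite seed $\Sigma^{\mathrm{opp}}$ of $\Sigma=(B,\mathbf p,\mathbf x)$ has exchange matrix $-B$, coefficients $(p^{\mathrm{opp}})_j^{\pm}=p_j^{\mp}$, and the same cluster; $\overline{\mathcal E}^{\mathrm{opp}}$ is the seed pattern of opposite seeds of $\overline{\mathcal E}$. For a quasi-homomorphism from $\mathcal E$ to $\overline{\mathcal E}^{\mathrm{opp}}$, the exchange matrix of $\Psi(\Sigma(t))$ is $B(t)$, so in that case $B(t)=-\overline B(\overline t)$. Seed orbit equivalence: $(B,\mathbf p,\mathbf x)\sim(B^*,\mathbf p^*,\mathbf x^* )$ if $B=B^*$ and there are $c_j,d_j$ in the coefficient group with $x_j^*=x_j/c_j$ and $(p^* )_j^{\pm}=\frac{p_j^{\pm}}{d_j}\prod_i c_i^{[\pm b_{ij}]_+}$; equivalently $B=B^*$, each $x_j^*/x_j$ lies in the coefficient group, and the elements $\hat y_j=\frac{p_j^+}{p_j^-}\prod_i x_i^{b_{ij}}$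 agree for the two seeds. A quasi-homomorphism from $\mathcal E$ to $\overline{\mathcal E}$ is a semifield homomorphism $\Psi:\mathcal F_{>0}\to\overline{\mathcal F}_{>0}$ with $\Psi(\mathbf P)\subset\overline{\mathbf P}$ such that $\Psi(\Sigma(t)):=(B(t),\Psi(\mathbf p(t)),\Psi(\mathbf x(t)))\sim\overline\Sigma(\overline t)$ for all $t$. *)

theory Defs
  imports "HOL-Analysis.Finite_Cartesian_Product"
begin

section \<open>Labeled regular trees\<close>

text \<open>Edge labels are the elements of a finite type \<open>'n\<close>, which plays the role of
  \<open>{1, \<dots>, n}\<close>. An undirected edge labeled \<open>k\<close> between \<open>u\<close> and \<open>v\<close> is stored as the two triples
  \<open>(u, k, v)\<close> and \<open>(v, k, u)\<close>.\<close>

record ('v, 'n) lgraph =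
  lverts :: "'v set"
  ledges :: "('v \<times> 'n \<times> 'v) set"

definition lgraph :: "('v, 'n) lgraph \<Rightarrow> bool" where
  "lgraph G \<longleftrightarrow>
     (\<forall>u k v. (u, k, v) \<in> ledges G \<longrightarrow> u \<in> lverts G \<and> v \<in> lverts G \<and> (v, k, u) \<in> ledges G)"

definition ladj :: "('v, 'n) lgraph \<Rightarrow> 'v \<Rightarrow> 'v \<Rightarrow> bool" where
  "ladj G u v \<longleftrightarrow> (\<exists>k. (u, k, v) \<in> ledges G)"

definition lconnected :: "('v, 'n) lgraph \<Rightarrow> bool" where
  "lconnected G \<longleftrightarrow>
     lverts G \<noteq> {} \<and> (\<forall>u\<in>lverts G. \<forall>v\<in>lverts G. (ladj G)\<^sup>*\<^sup>* u v)"

definition lcycle :: "('v, 'n) lgraph \<Rightarrow> 'v list \<Rightarrow> bool" where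
  "lcycle G vs \<longleftrightarrow>
     3 \<le> length vs \<and> distinct vs \<and> successively (ladj G) vs \<and> ladj G (last vs) (hd vs)"

definition labeled_regular_tree :: "('v, 'n) lgraph \<Rightarrow> bool" where
  "labeled_regular_tree T \<longleftrightarrow>
     lgraph T \<and> lconnected T \<and>
     (\<forall>u. \<not> ladj T u u) \<and>
     (\<forall>u v k l. (u, k, v) \<in> ledges T \<and> (u, l, v) \<in> ledges T \<longrightarrow> k = l) \<and>
     (\<nexists>vs. lcycle T vs) \<and>
     (\<forall>u\<in>lverts T. \<forall>k. \<exists>!v. (u, k, v) \<in> ledges T)"

definition labeled_iso :: "('v, 'n) lgraph \<Rightarrow> ('w, 'n) lgraph \<Rightarrow> ('v \<Rightarrow> 'w) \<Rightarrow> bool" where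
  "labeled_iso T T' \<phi> \<longleftrightarrow>
     bij_betw \<phi> (lverts T) (lverts T') \<and>
     (\<forall>u\<in>lverts T. \<forall>v\<in>lverts T. \<forall>k. (u, k, v) \<in> ledges T \<longleftrightarrow> (\<phi> u, k, \<phi> v) \<in> ledges T')"

definition nerve :: "('v, 'n) lgraph \<Rightarrow> ('v, 'n) lgraph \<Rightarrow> bool" where
  "nerve N T \<longleftrightarrow>
     lgraph N \<and> lverts N \<subseteq> lverts T \<and> ledges N \<subseteq> ledges T \<and> lconnected N \<and>
     (\<forall>k. \<exists>u v. (u, k, v) \<in> ledges N)"


section \<open>Coefficient groups and free generation\<close>

text \<open>The ambient field \<open>\<F>\<close> is a whole type \<open>'f\<close> and the coefficient group is a multiplicative
  subgroup \<open>P\<close> of it. That the elements of \<open>P\<close> are linearly independent over the rationals says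
  that their rational span in \<open>'f\<close> is the group ring \<open>\<rat>P\<close>. That \<open>'f\<close> is a field of rational
  functions in \<open>n\<close> variables over \<open>P\<close> is then part of the freeness condition on clusters.\<close>

interpretation rat_vs: vector_space "\<lambda>(q::rat) (z::'f::field_char_0). of_rat q * z"
  by unfold_locales (simp_all add: algebra_simps of_rat_add of_rat_mult)

definition group_ring :: "'f::field_char_0 set \<Rightarrow> 'f set" where
  "group_ring P = rat_vs.span P"

definition coefficient_group :: "'f::field_char_0 set \<Rightarrow> bool" where
  "coefficient_group P \<longleftrightarrow>
     0 \<notin> P \<and> 1 \<in> P \<and> (\<forall>p\<in>P. \<forall>q\<in>P. p * q \<in> P) \<and> (\<forall>p\<in>P. inverse p \<in> P) \<and>
     (\<forall>p\<in>P. \<forall>m>0. p ^ m = 1 \<longrightarrow> p = 1) \<and>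
     rat_vs.independent P"

definition algebraically_independent :: "'f::field set \<Rightarrow> ('n::finite \<Rightarrow> 'f) \<Rightarrow> bool" where
  "algebraically_independent R x \<longleftrightarrow>
     (\<forall>(M :: ('n \<Rightarrow> nat) set) c.
        finite M \<and> (\<forall>m\<in>M. c m \<in> R) \<and> (\<Sum>m\<in>M. c m * (\<Prod>i\<in>UNIV. x i ^ m i)) = 0 \<longrightarrow>
        (\<forall>m\<in>M. c m = 0))"

definition is_subfield :: "'f::field set \<Rightarrow> bool" where
  "is_subfield K \<longleftrightarrow>
     0 \<in> K \<and> 1 \<in> K \<and> (\<forall>a\<in>K. \<forall>b\<in>K. a + b \<in> K \<and> a * b \<in> K) \<and>
     (\<forall>a\<in>K. - a \<in> K \<and> inverse a \<in> K)"

definition freely_generates :: "'f::field_char_0 set \<Rightarrow> ('n::finite \<Rightarrow> 'f) \<Rightarrow> bool" where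
  "freely_generates P x \<longleftrightarrow>
     algebraically_independent (group_ring P) x \<and>
     is_subfield hull (group_ring P \<union> range x) = UNIV"


section \<open>Seeds and mutations\<close>

definition pos_part :: "int \<Rightarrow> int" where
  "pos_part b = max b 0"

definition skew_symmetrizable :: "int^'n^'n::finite \<Rightarrow> bool" where
  "skew_symmetrizable B \<longleftrightarrow>
     (\<exists>d :: 'n \<Rightarrow> int. (\<forall>i. d i > 0) \<and> (\<forall>i j. d i * B $ i $ j = - (d j * B $ j $ i)))"

record ('f, 'n) seed =
  exmat :: "int^'n^'n"
  pplus :: "'n \<Rightarrow> 'f"
  pminus :: "'n \<Rightarrow> 'f"
  cluster :: "'n \<Rightarrow> 'f"

definition nn_seed :: "'f::field_char_0 set \<Rightarrow> ('f, 'n::finite) seed \<Rightarrow> bool" where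
  "nn_seed P S \<longleftrightarrow>
     skew_symmetrizable (exmat S) \<and>
     (\<forall>j. pplus S j \<in> P \<and> pminus S j \<in> P) \<and>
     freely_generates P (cluster S)"

definition mutation :: "'n \<Rightarrow> ('f::field, 'n::finite) seed \<Rightarrow> ('f, 'n) seed \<Rightarrow> bool" where
  "mutation k S S' \<longleftrightarrow>
     (let B = exmat S; B' = exmat S'; x = cluster S; x' = cluster S' in
       (\<forall>i j. B' $ i $ j =
          (if i = k \<or> j = k then - (B $ i $ j)
           else B $ i $ j + sgn (B $ i $ k) * pos_part (B $ i $ k * B $ k $ j))) \<and>
       pplus S' k = pminus S k \<and> pminus S' k = pplus S k \<and>
       (\<forall>j. j \<noteq> k \<longrightarrow>
          (B $ k $ j \<ge> 0 \<longrightarrow>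
             pplus S' j / pminus S' j = pplus S j / pminus S j * pplus S k powi (B $ k $ j)) \<and>
          (B $ k $ j \<le> 0 \<longrightarrow>
             pplus S' j / pminus S' j = pplus S j / pminus S j * pminus S k powi (B $ k $ j))) \<and>
       (\<forall>j. j \<noteq> k \<longrightarrow> x' j = x j) \<and>
       x k * x' k =
         pplus S k * (\<Prod>j\<in>UNIV. x j powi pos_part (B $ j $ k)) +
         pminus S k * (\<Prod>j\<in>UNIV. x j powi pos_part (- (B $ j $ k))))"

definition indecomposable :: "('f, 'n::finite) seed \<Rightarrow> bool" where
  "indecomposable S \<longleftrightarrow>
     (\<forall>i j. (\<lambda>a b. exmat S $ a $ b \<noteq> 0 \<or> exmat S $ b $ a \<noteq> 0)\<^sup>*\<^sup>* i j)"

definition opp_seed :: "('f, 'n::finite) seed \<Rightarrow> ('f, 'n) seed" where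
  "opp_seed S =
     \<lparr>exmat = - exmat S, pplus = pminus S, pminus = pplus S, cluster = cluster S\<rparr>"


section \<open>Seed patterns\<close>

record ('v, 'f, 'n) pattern =
  coeffs :: "'f set"
  tree :: "('v, 'n) lgraph"
  seed_at :: "'v \<Rightarrow> ('f, 'n) seed"

definition seed_pattern :: "('v, 'f::field_char_0, 'n::finite) pattern \<Rightarrow> bool" where
  "seed_pattern E \<longleftrightarrow>
     coefficient_group (coeffs E) \<and> labeled_regular_tree (tree E) \<and>
     (\<forall>t\<in>lverts (tree E). nn_seed (coeffs E) (seed_at E t)) \<and>
     (\<forall>t k t'. (t, k, t') \<in> ledges (tree E) \<longrightarrow> mutation k (seed_at E t) (seed_at E t'))"

definition opp_pattern :: "('v, 'f, 'n::finite) pattern \<Rightarrow> ('v, 'f, 'n) pattern" where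
  "opp_pattern E = E\<lparr>seed_at := \<lambda>t. opp_seed (seed_at E t)\<rparr>"

inductive_set subtraction_free :: "'f::field set \<Rightarrow> ('n \<Rightarrow> 'f) \<Rightarrow> 'f set"
  for P :: "'f set" and x :: "'n \<Rightarrow> 'f" where
  coeff: "p \<in> P \<Longrightarrow> p \<in> subtraction_free P x"
| var: "x j \<in> subtraction_free P x"
| add: "a \<in> subtraction_free P x \<Longrightarrow> b \<in> subtraction_free P x \<Longrightarrow> a + b \<in> subtraction_free P x"
| mult: "a \<in> subtraction_free P x \<Longrightarrow> b \<in> subtraction_free P x \<Longrightarrow> a * b \<in> subtraction_free P x"
| divide: "a \<in> subtraction_free P x \<Longrightarrow> b \<in> subtraction_free P x \<Longrightarrow> a / b \<in> subtraction_free P x"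

text \<open>For a seed pattern all members of the following union coincide, since each exchange
  relation expresses the new cluster variable without subtraction.\<close>

definition ambient_semifield :: "('v, 'f::field, 'n::finite) pattern \<Rightarrow> 'f set" where
  "ambient_semifield E =
     (\<Union>t\<in>lverts (tree E). subtraction_free (coeffs E) (cluster (seed_at E t)))"


section \<open>Quasi-homomorphisms\<close>

definition semifield_hom :: "'f::field set \<Rightarrow> 'g::field set \<Rightarrow> ('f \<Rightarrow> 'g) \<Rightarrow> bool" where
  "semifield_hom A A' \<Psi> \<longleftrightarrow>
     \<Psi> ` A \<subseteq> A' \<and>
     (\<forall>a\<in>A. \<forall>b\<in>A. \<Psi> (a + b) = \<Psi> a + \<Psi> b \<and> \<Psi> (a * b) = \<Psi> a * \<Psi> b)"

definition seed_orbit_equiv ::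
  "'f::field set \<Rightarrow> ('f, 'n::finite) seed \<Rightarrow> ('f, 'n) seed \<Rightarrow> bool" where
  "seed_orbit_equiv P S S' \<longleftrightarrow>
     exmat S = exmat S' \<and>
     (\<exists>c d. (\<forall>j. c j \<in> P \<and> d j \<in> P) \<and>
        (\<forall>j. cluster S' j = cluster S j / c j \<and>
             pplus S' j = pplus S j / d j * (\<Prod>i\<in>UNIV. c i powi pos_part (exmat S $ i $ j)) \<and>
             pminus S' j = pminus S j / d j * (\<Prod>i\<in>UNIV. c i powi pos_part (- (exmat S $ i $ j)))))"

definition image_seed :: "('f \<Rightarrow> 'g) \<Rightarrow> ('f, 'n::finite) seed \<Rightarrow> ('g, 'n) seed" where
  "image_seed \<Psi> S =
     \<lparr>exmat = exmat S, pplus = \<Psi> \<circ> pplus S, pminus = \<Psi> \<circ> pminus S, cluster = \<Psi> \<circ> cluster S\<rparr>"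

definition quasi_hom ::
  "('v, 'f::field_char_0, 'n::finite) pattern \<Rightarrow> ('w, 'g::field_char_0, 'n) pattern \<Rightarrow>
   ('v \<Rightarrow> 'w) \<Rightarrow> ('f \<Rightarrow> 'g) \<Rightarrow> bool" where
  "quasi_hom E E' \<phi> \<Psi> \<longleftrightarrow>
     semifield_hom (ambient_semifield E) (ambient_semifield E') \<Psi> \<and>
     \<Psi> ` coeffs E \<subseteq> coeffs E' \<and>
     (\<forall>t\<in>lverts (tree E).
        seed_orbit_equiv (coeffs E') (image_seed \<Psi> (seed_at E t)) (seed_at E' (\<phi> t)))"

end

(*
  Let y_k be the quotient of the two terms of the exchange relation in direction k. If the
  exchange relation crosses an edge of the nerve, its image and the barred exchange relation are
  two expressions of the same element as a sum of two monomials; linear independence of monomials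
  then gives a sign e with column k of B equal to e times the barred column and with y_k mapped to
  the barred y_k to the power e. This property is preserved by a mutation in direction i along the
  nerve: either b_ik = 0 and column k and y_k do not change, or the signs at i and k agree by
  skew-symmetrizability and the mutation rule for y applies. So the sign depends only on k, and
  labels joined in the graph of an indecomposable seed share it. With one sign for all labels the
  seeds at a vertex of the nerve are orbit equivalent up to passing to the opposite pattern, and
  mutation carries this over the whole tree.
*)

theory Submission
  imports Defs
begin

text \<open>The quotient of the two terms of the exchange relation in direction \<open>j\<close>. It
  takes the same value on orbit-equivalent seeds, so the two patterns can be compared through it
  without choosing scalars.\<close>

definition yhat :: "('f::field, 'n::finite) seed \<Rightarrow> 'n \<Rightarrow> 'f" where
  "yhat S j = pplus S j / pminus S j * (\<Prod>i\<in>UNIV. cluster S i powi (exmat S $ i $ j))"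

section \<open>Positive parts and products of integer powers\<close>

lemma pos_part_diff: "pos_part b - pos_part (- b) = b"
  by (simp add: pos_part_def max_def)

lemma pos_part_nonneg [simp]: "0 \<le> pos_part b"
  by (simp add: pos_part_def)

lemma pos_part_eq_iff: "pos_part a = pos_part b \<and> pos_part (- a) = pos_part (- b) \<longleftrightarrow> a = b"
  by (auto simp: pos_part_def max_def split: if_splits)

lemma prod_powi_pos_part:
  fixes x :: "'n::finite \<Rightarrow> 'f::field"
  assumes "\<And>i. x i \<noteq> 0"
  shows "(\<Prod>i\<in>UNIV. x i powi pos_part (b i)) =
    (\<Prod>i\<in>UNIV. x i powi pos_part (- b i)) * (\<Prod>i\<in>UNIV. x i powi b i)"
proof -
  have "x i powi pos_part (b i) = x i powi pos_part (- b i) * x i powi b i" for i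
    using assms[of i] pos_part_diff[of "b i"] power_int_add[of "x i" "pos_part (- b i)" "b i"]
    by (simp add: algebra_simps)
  then show ?thesis by (simp add: prod.distrib)
qed

text \<open>Seeds use integer exponents, whereas algebraic independence is stated with natural ones;
  this passes from the first to the second.\<close>

lemma prod_powi_eq_monomial:
  "(\<Prod>i\<in>UNIV. x i powi pos_part (b i)) = (\<Prod>i\<in>UNIV. x i ^ nat (pos_part (b i)))"
  for x :: "'n::finite \<Rightarrow> 'f::field"
  by (simp add: power_int_def)

lemma prod_powi_distrib: "(\<Prod>i\<in>I. f i powi b) = (\<Prod>i\<in>I. f i) powi b"
  for f :: "'b \<Rightarrow> 'f::field"
  by (induction I rule: infinite_finite_induct) (simp_all add: power_int_mult_distrib)

lemma prod_mult_powi: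
  "(\<Prod>i\<in>UNIV. (c i * x i) powi b i) = (\<Prod>i\<in>UNIV. c i powi b i) * (\<Prod>i\<in>UNIV. x i powi b i)"
  for x :: "'n::finite \<Rightarrow> 'f::field"
  by (simp add: power_int_mult_distrib prod.distrib)


section \<open>Coefficient groups and monomials\<close>

lemma coefficient_groupD:
  assumes "coefficient_group P"
  shows "0 \<notin> P" "1 \<in> P" "p \<in> P \<Longrightarrow> q \<in> P \<Longrightarrow> p * q \<in> P" "p \<in> P \<Longrightarrow> inverse p \<in> P"
    "p \<in> P \<Longrightarrow> q \<in> P \<Longrightarrow> p / q \<in> P"
  using assms by (auto simp: coefficient_group_def field_class.field_divide_inverse)

lemma coefficient_group_powi:
  assumes "coefficient_group P" "p \<in> P"
  shows "p powi b \<in> P"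
proof -
  have "q ^ m \<in> P" if "q \<in> P" for q m
    using that by (induction m) (auto intro: coefficient_groupD[OF assms(1)])
  then show ?thesis
    using assms coefficient_groupD(4)[OF assms(1)] by (auto simp: power_int_def)
qed

lemma coefficient_group_prod:
  assumes "coefficient_group P" "\<And>i. i \<in> I \<Longrightarrow> p i \<in> P"
  shows "(\<Prod>i\<in>I. p i) \<in> P"
  using assms(2)
  by (induction I rule: infinite_finite_induct) (auto intro: coefficient_groupD[OF assms(1)])

text \<open>Two independence statements are combined. Collecting terms by exponent vector gives
  coefficients in the group ring, which vanish by algebraic independence of \<open>x\<close>;
  independence of \<open>P\<close> over the rationals then kills each rational coefficient.\<close>

lemma monomials_independent:
  fixes x :: "'n::finite \<Rightarrow> 'f::field_char_0" and f :: "'f \<times> ('n \<Rightarrow> nat) \<Rightarrow> rat"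
  assumes P: "coefficient_group P" and x: "algebraically_independent (group_ring P) x"
    and F: "finite F" "fst ` F \<subseteq> P"
    and sum0: "(\<Sum>z\<in>F. of_rat (f z) * (fst z * (\<Prod>i\<in>UNIV. x i ^ snd z i))) = 0"
    and z: "z \<in> F"
  shows "f z = 0"
proof -
  define C where "C m = {p. (p, m) \<in> F}" for m
  define c where "c m = (\<Sum>p\<in>C m. of_rat (f (p, m)) * p)" for m
  have finC: "finite (C m)" for m
    by (rule finite_subset[OF _ finite_imageI[OF F(1), of fst]]) (force simp: C_def)
  have CP: "C m \<subseteq> P" for m
    using F(2) by (force simp: C_def)
  have "c m \<in> group_ring P" for m
    unfolding c_def group_ring_def
    by (intro rat_vs.span_sum rat_vs.span_scale rat_vs.span_base) (use CP in blast)
  moreover have "(\<Sum>m\<in>snd ` F. c m * (\<Prod>i\<in>UNIV. x i ^ m i)) = 0"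
  proof -
    have "(\<Sum>m\<in>snd ` F. c m * (\<Prod>i\<in>UNIV. x i ^ m i)) =
      (\<Sum>m\<in>snd ` F. \<Sum>p\<in>C m. of_rat (f (p, m)) * (p * (\<Prod>i\<in>UNIV. x i ^ m i)))"
      by (simp add: c_def sum_distrib_right mult.assoc)
    also have "\<dots> = (\<Sum>(m, p)\<in>Sigma (snd ` F) C. of_rat (f (p, m)) * (p * (\<Prod>i\<in>UNIV. x i ^ m i)))"
      using F(1) finC by (simp add: sum.Sigma)
    also have "\<dots> = (\<Sum>z\<in>F. of_rat (f z) * (fst z * (\<Prod>i\<in>UNIV. x i ^ snd z i)))"
      by (rule sum.reindex_bij_witness[of _ prod.swap prod.swap]) (force simp: C_def)+
    finally show ?thesis using sum0 by simp
  qed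
  ultimately have "c m = 0" if "m \<in> snd ` F" for m
    using x F(1) that unfolding algebraically_independent_def by blast
  then have "c (snd z) = 0" using z by blast
  moreover have "rat_vs.independent P"
    using P by (simp add: coefficient_group_def)
  moreover have "fst z \<in> C (snd z)" using z by (simp add: C_def)
  ultimately have "f (fst z, snd z) = 0"
    using rat_vs.independentD[OF _ finC CP, of "\<lambda>p. f (p, snd z)"] unfolding c_def by blast
  then show ?thesis by simp
qed

text \<open>Moving everything to one side gives a vanishing rational combination of the monomials
  given by the pairs in \<open>F\<close>, so the two sides agree as multisets of pairs of a
  coefficient and an exponent vector.\<close>

lemma two_monomials_eq:
  fixes x :: "'n::finite \<Rightarrow> 'f::field_char_0"
  assumes P: "coefficient_group P" and x: "algebraically_independent (group_ring P) x"
    and coeffs: "p \<in> P" "q \<in> P" "r \<in> P" "s \<in> P"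
    and eq: "p * (\<Prod>i\<in>UNIV. x i ^ a i) + q * (\<Prod>i\<in>UNIV. x i ^ b i) =
      r * (\<Prod>i\<in>UNIV. x i ^ c i) + s * (\<Prod>i\<in>UNIV. x i ^ d i)"
  shows "p = r \<and> a = c \<and> q = s \<and> b = d \<or> p = s \<and> a = d \<and> q = r \<and> b = c"
proof -
  define F where "F = {(p, a), (q, b), (r, c), (s, d)}"
  define mon where "mon z = fst z * (\<Prod>i\<in>UNIV. x i ^ snd z i)" for z :: "'f \<times> ('n \<Rightarrow> nat)"
  \<comment> \<open>Summing indicators takes care of coincidences among the four pairs: a repeated
    pair receives its total multiplicity.\<close>
  define f :: "'f \<times> ('n \<Rightarrow> nat) \<Rightarrow> rat" where
    "f z = of_bool (z = (p, a)) + of_bool (z = (q, b)) - of_bool (z = (r, c)) - of_bool (z = (s, d))" for z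
  have fin: "finite F" by (simp add: F_def)
  have delta: "(\<Sum>z\<in>F. of_rat (of_bool (z = w)) * mon z) = mon w" if "w \<in> F" for w
  proof -
    have "(\<Sum>z\<in>F. of_rat (of_bool (z = w)) * mon z) = (\<Sum>z\<in>F. if z = w then mon z else 0)"
      by (rule sum.cong) auto
    then show ?thesis using that fin by simp
  qed
  have "(\<Sum>z\<in>F. of_rat (f z) * mon z) = mon (p, a) + mon (q, b) - mon (r, c) - mon (s, d)"
    unfolding f_def of_rat_add of_rat_diff left_diff_distrib distrib_right sum.distrib sum_subtractf
    by (subst (1 2 3 4) delta) (simp_all add: F_def)
  also have "\<dots> = 0" using eq by (simp add: mon_def)
  finally have "f z = 0" if "z \<in> F" for z
    using monomials_independent[OF P x fin _ _ that, of f] coeffs by (auto simp: F_def mon_def)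
  then have "f (p, a) = 0" "f (q, b) = 0" "f (r, c) = 0" "f (s, d) = 0"
    by (simp_all add: F_def)
  then show ?thesis by (auto simp: f_def of_bool_def split: if_splits)
qed

text \<open>If \<open>x i\<close> were zero, the single monomial \<open>x i\<close> with coefficient
  1 would be a nontrivial relation.\<close>

lemma algebraically_independent_nonzero:
  fixes x :: "'n::finite \<Rightarrow> 'f::field"
  assumes "algebraically_independent R x" "1 \<in> R"
  shows "x i \<noteq> 0"
proof
  assume "x i = 0"
  define m where "m j = (if j = i then 1 else 0 :: nat)" for j
  have "(\<Prod>j\<in>UNIV. x j ^ m j) = 0"
    using \<open>x i = 0\<close> by (auto simp: m_def intro!: prod_zero bexI[of _ i])
  then have "\<forall>m\<in>{m}. (\<lambda>_. 1) m = (0 :: 'f)"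
    using assms unfolding algebraically_independent_def
    by (elim allE[of _ "{m}"] allE[of _ "\<lambda>_. 1"]) auto
  then show False by simp
qed


section \<open>Seeds, mutations and opposites\<close>

lemma nn_seedD:
  assumes "coefficient_group P" "nn_seed P S"
  shows "pplus S j \<in> P" "pminus S j \<in> P" "pplus S j \<noteq> 0" "pminus S j \<noteq> 0" "cluster S j \<noteq> 0"
    "skew_symmetrizable (exmat S)" "algebraically_independent (group_ring P) (cluster S)"
proof -
  show "pplus S j \<in> P" "pminus S j \<in> P"
    using assms(2) by (auto simp: nn_seed_def)
  then show "pplus S j \<noteq> 0" "pminus S j \<noteq> 0"
    using coefficient_groupD(1)[OF assms(1)] by metis+
  have "1 \<in> group_ring P"
    using coefficient_groupD(2)[OF assms(1)] by (simp add: group_ring_def rat_vs.span_base)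
  then show "cluster S j \<noteq> 0"
    using assms(2) algebraically_independent_nonzero by (auto simp: nn_seed_def freely_generates_def)
qed (use assms in \<open>auto simp: nn_seed_def freely_generates_def\<close>)

text \<open>The positive weights drop out on passing to signs, so the sign pattern of
  \<open>B\<close> is skew-symmetric even where its entries are not.\<close>

lemma skew_symmetrizableD:
  assumes "skew_symmetrizable B"
  shows "B $ i $ i = 0" "B $ i $ j > 0 \<longleftrightarrow> B $ j $ i < 0"
    "B $ i $ j < 0 \<longleftrightarrow> B $ j $ i > 0" "B $ i $ j = 0 \<longleftrightarrow> B $ j $ i = 0"
proof -
  obtain d where d: "\<And>i. d i > 0" "\<And>i j. d i * B $ i $ j = - (d j * B $ j $ i)"
    using assms by (auto simp: skew_symmetrizable_def)
  show "B $ i $ i = 0" using d(1)[of i] d(2)[of i i] by simp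
  have sgn: "sgn (B $ i $ j) = - sgn (B $ j $ i)"
    using arg_cong[OF d(2)[of i j], of sgn] d(1)[of i] d(1)[of j] by (simp add: sgn_mult)
  show "B $ i $ j > 0 \<longleftrightarrow> B $ j $ i < 0" "B $ i $ j < 0 \<longleftrightarrow> B $ j $ i > 0"
    "B $ i $ j = 0 \<longleftrightarrow> B $ j $ i = 0"
    using sgn by (auto simp: sgn_if split: if_splits)
qed

lemma mutationD:
  assumes "mutation k S S'"
  shows "i = k \<or> j = k \<Longrightarrow> exmat S' $ i $ j = - exmat S $ i $ j"
    "i \<noteq> k \<Longrightarrow> j \<noteq> k \<Longrightarrow> exmat S' $ i $ j =
       exmat S $ i $ j + sgn (exmat S $ i $ k) * pos_part (exmat S $ i $ k * exmat S $ k $ j)"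
    "pplus S' k = pminus S k" "pminus S' k = pplus S k"
    "j \<noteq> k \<Longrightarrow> exmat S $ k $ j \<ge> 0 \<Longrightarrow>
       pplus S' j / pminus S' j = pplus S j / pminus S j * pplus S k powi (exmat S $ k $ j)"
    "j \<noteq> k \<Longrightarrow> exmat S $ k $ j \<le> 0 \<Longrightarrow>
       pplus S' j / pminus S' j = pplus S j / pminus S j * pminus S k powi (exmat S $ k $ j)"
    "j \<noteq> k \<Longrightarrow> cluster S' j = cluster S j"
    "cluster S k * cluster S' k =
         pplus S k * (\<Prod>j\<in>UNIV. cluster S j powi pos_part (exmat S $ j $ k)) +
         pminus S k * (\<Prod>j\<in>UNIV. cluster S j powi pos_part (- (exmat S $ j $ k)))"
  using assms by (auto simp: mutation_def Let_def)

text \<open>Pulling the minus term out of the exchange relation leaves a bracket that depends only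
  on \<open>yhat\<close>.\<close>

lemma exchange_yhat:
  assumes "mutation k S S'" "\<And>i. cluster S i \<noteq> 0" "pminus S k \<noteq> 0"
  shows "cluster S k * cluster S' k =
    pminus S k * (\<Prod>j\<in>UNIV. cluster S j powi pos_part (- (exmat S $ j $ k))) * (1 + yhat S k)"
  unfolding mutationD(8)[OF assms(1)] yhat_def
  using prod_powi_pos_part[of "cluster S" "\<lambda>j. exmat S $ j $ k"] assms(2,3)
  by (simp add: field_simps)

text \<open>Column \<open>k\<close> is negated and the two coefficients are swapped; the only
  variable that changes has exponent 0, because the diagonal entry vanishes.\<close>

lemma yhat_mutation_self:
  assumes "mutation k S S'" "skew_symmetrizable (exmat S)"
  shows "yhat S' k = inverse (yhat S k)"
proof -
  have "cluster S' i powi (exmat S' $ i $ k) = inverse (cluster S i powi (exmat S $ i $ k))" for i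
    using mutationD(1)[OF assms(1), of i k] mutationD(7)[OF assms(1), of i]
      skew_symmetrizableD(1)[OF assms(2), of k]
    by (cases "i = k") (auto simp: power_int_minus)
  then show ?thesis
    using mutationD(3,4)[OF assms(1)] by (simp add: yhat_def prod_inversef[unfolded comp_def] divide_inverse mult_ac)
qed

text \<open>The mutation rule for Y-variables. Its right-hand side contains nothing but
  \<open>yhat\<close> and one matrix entry, so a homomorphism can be applied to it directly.\<close>

lemma yhat_mutation_other:
  assumes mut: "mutation k S S'" and skew: "skew_symmetrizable (exmat S)"
    and x: "\<And>i. cluster S i \<noteq> 0" "cluster S' k \<noteq> 0"
    and p: "pplus S k \<noteq> 0" "pminus S k \<noteq> 0" and j: "j \<noteq> k"
  shows "yhat S' j = yhat S j *
    ((if exmat S $ k $ j \<ge> 0 then yhat S k else 1) / (1 + yhat S k)) powi (exmat S $ k $ j)"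
proof -
  define b where "b = exmat S $ k $ j"
  \<comment> \<open>The sign of \<open>b\<close> selects one term of the exchange relation:
    \<open>q * M\<close> is its plus term for \<open>b \<ge> 0\<close> and its minus term otherwise.
    With this choice the matrix rule adds \<open>s i * b\<close> to the entry in row
    \<open>i\<close>.\<close>
  define s where "s i = (if b \<ge> 0 then pos_part (exmat S $ i $ k) else pos_part (- exmat S $ i $ k))" for i
  define q where "q = (if b \<ge> 0 then pplus S k else pminus S k)"
  define M where "M = (\<Prod>i\<in>UNIV. cluster S i powi s i)"
  have skk: "exmat S $ k $ k = 0" using skew by (rule skew_symmetrizableD)
  have sk: "s k = 0" by (simp add: s_def skk pos_part_def)
  have expo: "exmat S' $ i $ j = exmat S $ i $ j + s i * b" if "i \<noteq> k" for i
    unfolding mutationD(2)[OF mut that j] b_def[symmetric] s_def pos_part_def max_def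
    by (auto simp: sgn_if mult_le_0_iff zero_le_mult_iff)
  have "(\<Prod>i\<in>UNIV. cluster S' i powi (exmat S' $ i $ j)) =
      cluster S' k powi (- b) * (\<Prod>i\<in>UNIV - {k}. cluster S' i powi (exmat S' $ i $ j))"
    using mutationD(1)[OF mut, of k j] by (subst prod.remove[of _ k]) (auto simp: b_def)
  also have "(\<Prod>i\<in>UNIV - {k}. cluster S' i powi (exmat S' $ i $ j)) =
      (\<Prod>i\<in>UNIV - {k}. cluster S i powi (exmat S $ i $ j) * (cluster S i powi s i) powi b)"
    using x expo by (intro prod.cong) (auto simp: mutationD(7)[OF mut] power_int_add power_int_mult)
  also have "\<dots> = (\<Prod>i\<in>UNIV - {k}. cluster S i powi (exmat S $ i $ j)) *
      (\<Prod>i\<in>UNIV - {k}. cluster S i powi s i) powi b"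
    by (simp add: prod.distrib prod_powi_distrib)
  also have "(\<Prod>i\<in>UNIV - {k}. cluster S i powi s i) = M"
    unfolding M_def by (subst prod.remove[of _ k]) (auto simp: sk)
  \<comment> \<open>Restoring the factor at \<open>k\<close> leaves \<open>cluster S k\<close> with
    exponent \<open>- b\<close>, the same as that of \<open>cluster S' k\<close>; together they form
    the left side of the exchange relation.\<close>
  also have "(\<Prod>i\<in>UNIV - {k}. cluster S i powi (exmat S $ i $ j)) =
      cluster S k powi (- b) * (\<Prod>i\<in>UNIV. cluster S i powi (exmat S $ i $ j))"
    using x(1)[of k] by (subst (2) prod.remove[of _ k]) (auto simp: b_def power_int_minus)
  finally have X: "(\<Prod>i\<in>UNIV. cluster S' i powi (exmat S' $ i $ j)) =
      (\<Prod>i\<in>UNIV. cluster S i powi (exmat S $ i $ j)) * (M / (cluster S k * cluster S' k)) powi b"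
    using x by (simp add: power_int_minus power_int_divide_distrib power_int_mult_distrib field_simps)
  have C: "pplus S' j / pminus S' j = pplus S j / pminus S j * q powi b"
    using mutationD(5,6)[OF mut j] by (auto simp: q_def b_def)
  have "yhat S' j = yhat S j * (q * M / (cluster S k * cluster S' k)) powi b"
    unfolding yhat_def X C by (simp add: power_int_divide_distrib power_int_mult_distrib)
  also have "q * M / (cluster S k * cluster S' k) = (if b \<ge> 0 then yhat S k else 1) / (1 + yhat S k)"
  proof -
    \<comment> \<open>\<open>D\<close> is the minus term; it occurs in the selected term and in the
      factored exchange relation, and cancels.\<close>
    define D where "D = pminus S k * (\<Prod>j\<in>UNIV. cluster S j powi pos_part (- (exmat S $ j $ k)))"
    have "D \<noteq> 0" using x p by (simp add: D_def)
    moreover have "q * M = D * (if b \<ge> 0 then yhat S k else 1)"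
      using prod_powi_pos_part[of "cluster S" "\<lambda>j. exmat S $ j $ k"] x p
      by (simp add: q_def M_def D_def s_def yhat_def)
    ultimately show ?thesis
      unfolding exchange_yhat[OF mut x(1) p(2)] D_def[symmetric] by simp
  qed
  finally show ?thesis by (simp add: b_def)
qed

text \<open>Otherwise the factored exchange relation would make a product of two nonzero cluster
  variables vanish.\<close>

lemma one_plus_yhat_nonzero:
  assumes "mutation k S S'" "\<And>i. cluster S i \<noteq> 0" "cluster S' k \<noteq> 0" "pminus S k \<noteq> 0"
  shows "1 + yhat S k \<noteq> 0"
  using exchange_yhat[OF assms(1,2,4)] assms(2)[of k] assms(3) by auto

lemma opp_seed_simps [simp]:
  "exmat (opp_seed S) $ i $ j = - exmat S $ i $ j" "pplus (opp_seed S) = pminus S"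
  "pminus (opp_seed S) = pplus S" "cluster (opp_seed S) = cluster S"
  by (simp_all add: opp_seed_def)

lemma opp_seed_opp_seed [simp]: "opp_seed (opp_seed S) = (S :: ('f, 'n::finite) seed)"
  by (simp add: opp_seed_def)

lemma nn_seed_opp:
  assumes "nn_seed P S"
  shows "nn_seed P (opp_seed S)"
proof -
  obtain d where d: "\<And>i. d i > 0" "\<And>i j. d i * exmat S $ i $ j = - (d j * exmat S $ j $ i)"
    using assms by (auto simp: nn_seed_def skew_symmetrizable_def)
  have "skew_symmetrizable (exmat (opp_seed S))"
    unfolding skew_symmetrizable_def
  proof (intro exI[of _ d] conjI allI)
    show "d i * exmat (opp_seed S) $ i $ j = - (d j * exmat (opp_seed S) $ j $ i)" for i j
      using d(2)[of i j] by simp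
  qed (rule d)
  then show ?thesis using assms by (simp add: nn_seed_def)
qed

text \<open>Negating the matrix interchanges the two sign cases of the coefficient rule and the two
  terms of the exchange relation, in step with the swap of \<open>pplus\<close> and
  \<open>pminus\<close>.\<close>

lemma mutation_opp:
  assumes "mutation k S S'"
  shows "mutation k (opp_seed S) (opp_seed S')"
proof -
  note m = mutationD[OF assms]
  have mat: "exmat (opp_seed S') $ i $ j = (if i = k \<or> j = k then - (exmat (opp_seed S) $ i $ j)
      else exmat (opp_seed S) $ i $ j + sgn (exmat (opp_seed S) $ i $ k) *
        pos_part (exmat (opp_seed S) $ i $ k * exmat (opp_seed S) $ k $ j))" for i j
    using m(1,2)[of i j] by auto
  have inv: "pminus S' j / pplus S' j = pminus S j / pplus S j * q powi (- b)"
    if "pplus S' j / pminus S' j = pplus S j / pminus S j * q powi b" for j q b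
    using arg_cong[OF that, of inverse] by (simp add: power_int_minus divide_inverse mult_ac)
  show ?thesis
    unfolding mutation_def Let_def
    using mat m(3,4,7,8) inv[OF m(5)] inv[OF m(6)] by (auto simp: add.commute)
qed

lemma opp_pattern_simps [simp]:
  "coeffs (opp_pattern E) = coeffs E" "tree (opp_pattern E) = tree E"
  "seed_at (opp_pattern E) t = opp_seed (seed_at E t)"
  by (simp_all add: opp_pattern_def)

lemma seed_pattern_opp: "seed_pattern E \<Longrightarrow> seed_pattern (opp_pattern E)"
  by (simp add: seed_pattern_def nn_seed_opp mutation_opp)

lemma ambient_semifield_opp [simp]: "ambient_semifield (opp_pattern E) = ambient_semifield E"
  by (simp add: ambient_semifield_def)


section \<open>Ambient semifields\<close>

text \<open>The exchange relation writes the new variable as a subtraction-free expression divided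
  by the old variable.\<close>

lemma subtraction_free_mutation:
  assumes P: "coefficient_group P" and S: "nn_seed P S" and mut: "mutation k S S'"
  shows "subtraction_free P (cluster S') \<subseteq> subtraction_free P (cluster S)"
proof -
  let ?K = "subtraction_free P (cluster S)"
  note nn = nn_seedD[OF P S]
  have one: "1 \<in> ?K"
    using coefficient_groupD(2)[OF P] by (rule subtraction_free.coeff)
  have pow: "cluster S i ^ m \<in> ?K" for i m
    by (induction m) (auto intro: one subtraction_free.intros)
  have prod: "(\<Prod>i\<in>I. f i) \<in> ?K" if "\<And>i. f i \<in> ?K" for I and f :: "'b \<Rightarrow> 'a"
    using that by (induction I rule: infinite_finite_induct) (auto intro: one subtraction_free.mult)
  have "cluster S k * cluster S' k \<in> ?K"
    unfolding mutationD(8)[OF mut] prod_powi_eq_monomial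
    by (intro subtraction_free.add subtraction_free.mult subtraction_free.coeff nn prod pow)
  then have "cluster S k * cluster S' k / cluster S k \<in> ?K"
    by (intro subtraction_free.divide subtraction_free.var)
  then have k: "cluster S' k \<in> ?K"
    using nn(5)[of k] by simp
  have "cluster S' j \<in> ?K" for j
    using k mutationD(7)[OF mut, of j] by (cases "j = k") (auto intro: subtraction_free.var)
  show ?thesis
  proof
    fix a assume "a \<in> subtraction_free P (cluster S')"
    then show "a \<in> ?K"
      by induction (simp_all add: subtraction_free.intros \<open>\<And>j. cluster S' j \<in> ?K\<close>)
  qed
qed

text \<open>Induction along a path; the form in which connectedness of the tree and of the nerve is
  used.\<close>

lemma lconnected_propagate:
  assumes G: "lgraph G" "lconnected G" and u: "u \<in> lverts G" "R u" and v: "v \<in> lverts G"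
    and step: "\<And>s k t. (s, k, t) \<in> ledges G \<Longrightarrow> R s \<Longrightarrow> R t"
  shows "R v"
proof -
  have "(ladj G)\<^sup>*\<^sup>* u v" using G u v by (auto simp: lconnected_def)
  then show ?thesis
    by induction (use u step in \<open>auto simp: ladj_def\<close>)
qed

lemma seed_patternD:
  assumes "seed_pattern E"
  shows "coefficient_group (coeffs E)" "lgraph (tree E)" "lconnected (tree E)"
    "t \<in> lverts (tree E) \<Longrightarrow> nn_seed (coeffs E) (seed_at E t)"
    "(t, k, t') \<in> ledges (tree E) \<Longrightarrow> mutation k (seed_at E t) (seed_at E t')"
    "(t, k, t') \<in> ledges (tree E) \<Longrightarrow> t \<in> lverts (tree E) \<and> t' \<in> lverts (tree E)"
  using assms unfolding seed_pattern_def labeled_regular_tree_def lgraph_def by blast+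

text \<open>Along a path starting at \<open>t\<close>, each further member of the union stays inside
  the one at \<open>t\<close>.\<close>

lemma ambient_semifield_eq:
  assumes E: "seed_pattern E" and t: "t \<in> lverts (tree E)"
  shows "ambient_semifield E = subtraction_free (coeffs E) (cluster (seed_at E t))"
proof -
  note E = seed_patternD[OF E]
  have "subtraction_free (coeffs E) (cluster (seed_at E s)) \<subseteq>
      subtraction_free (coeffs E) (cluster (seed_at E t))" if "s \<in> lverts (tree E)" for s
    by (rule lconnected_propagate[OF E(2,3) t _ that])
      (use subtraction_free_mutation[OF E(1,4,5)] E(6) in blast)+
  then show ?thesis
    using t unfolding ambient_semifield_def by blast
qed


section \<open>Matching seeds along a semifield homomorphism\<close>

text \<open>\<open>A\<close> stands for the ambient semifield of the source, given by closure
  conditions alone, so that single pairs of seeds can be treated with no tree present.\<close>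

locale positive_hom =
  fixes P A :: "'f::field_char_0 set" and Q :: "'g::field_char_0 set" and \<Psi> :: "'f \<Rightarrow> 'g"
  assumes P: "coefficient_group P" and Q: "coefficient_group Q"
    and P_le: "P \<subseteq> A"
    and add: "a \<in> A \<Longrightarrow> b \<in> A \<Longrightarrow> a + b \<in> A"
    and mult: "a \<in> A \<Longrightarrow> b \<in> A \<Longrightarrow> a * b \<in> A"
    and divide: "a \<in> A \<Longrightarrow> b \<in> A \<Longrightarrow> a / b \<in> A"
    and hom_add: "a \<in> A \<Longrightarrow> b \<in> A \<Longrightarrow> \<Psi> (a + b) = \<Psi> a + \<Psi> b"
    and hom_mult: "a \<in> A \<Longrightarrow> b \<in> A \<Longrightarrow> \<Psi> (a * b) = \<Psi> a * \<Psi> b"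
    and hom_P: "p \<in> P \<Longrightarrow> \<Psi> p \<in> Q"
begin

section \<open>Compatibility of the homomorphism with quotients, powers and products\<close>

lemma one: "1 \<in> A"
  using coefficient_groupD(2)[OF P] P_le by blast

text \<open>The image of 1 is idempotent, and it is nonzero because it lies in
  \<open>Q\<close>.\<close>

lemma hom_one: "\<Psi> 1 = 1"
proof -
  have "\<Psi> 1 \<noteq> 0"
    using hom_P[OF coefficient_groupD(2)[OF P]] coefficient_groupD(1)[OF Q] by metis
  then show ?thesis using hom_mult[OF one one] by simp
qed

text \<open>The product of \<open>b\<close> and \<open>1 / b\<close> is mapped to 1, so the image of
  \<open>b\<close> is invertible. That \<open>b\<close> is nonzero is assumed because the closure
  conditions on \<open>A\<close> do not exclude 0.\<close>

lemma hom_divide: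
  assumes "a \<in> A" "b \<in> A" "b \<noteq> 0"
  shows "\<Psi> (a / b) = \<Psi> a / \<Psi> b" and "\<Psi> b \<noteq> 0"
proof -
  show "\<Psi> b \<noteq> 0"
    using hom_mult[OF assms(2) divide[OF one assms(2)]] assms(3) hom_one by auto
  then show "\<Psi> (a / b) = \<Psi> a / \<Psi> b"
    using hom_mult[OF divide[OF assms(1,2)] assms(2)] assms(3) by (simp add: field_simps)
qed

lemma hom_powi:
  assumes "a \<in> A" "a \<noteq> 0"
  shows "a powi m \<in> A" and "\<Psi> (a powi m) = \<Psi> a powi m"
proof -
  have *: "b ^ n \<in> A \<and> \<Psi> (b ^ n) = \<Psi> b ^ n" if "b \<in> A" for b n
    by (induction n) (auto simp: one hom_one mult hom_mult that)
  have inv: "inverse a \<in> A" "\<Psi> (inverse a) = inverse (\<Psi> a)"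
    using divide[OF one assms(1)] hom_divide[OF one assms] by (simp_all add: hom_one field_simps)
  show "a powi m \<in> A" "\<Psi> (a powi m) = \<Psi> a powi m"
    using *[OF assms(1)] *[OF inv(1)] inv(2) by (auto simp: power_int_def)
qed

lemma hom_prod:
  assumes "\<And>i. i \<in> I \<Longrightarrow> f i \<in> A"
  shows "(\<Prod>i\<in>I. f i) \<in> A \<and> \<Psi> (\<Prod>i\<in>I. f i) = (\<Prod>i\<in>I. \<Psi> (f i))"
  using assms
  by (induction I rule: infinite_finite_induct) (auto simp: one hom_one mult hom_mult)

section \<open>Comparison of a source seed with a target seed\<close>

definition source_seed :: "('f, 'n::finite) seed \<Rightarrow> bool" where
  "source_seed S \<longleftrightarrow> nn_seed P S \<and> (\<forall>i. cluster S i \<in> A)"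

text \<open>Agreement at a single label, with sign +1. Since \<open>opp_seed\<close> negates the
  column and inverts \<open>yhat\<close>, the same predicate applied to \<open>opp_seed T\<close>
  expresses sign -1.\<close>

definition matching :: "('f, 'n::finite) seed \<Rightarrow> ('g, 'n) seed \<Rightarrow> 'n \<Rightarrow> bool" where
  "matching S T k \<longleftrightarrow> (\<forall>i. exmat S $ i $ k = exmat T $ i $ k) \<and> \<Psi> (yhat S k) = yhat T k"

definition proportional :: "('f, 'n::finite) seed \<Rightarrow> ('g, 'n) seed \<Rightarrow> 'n \<Rightarrow> bool" where
  "proportional S T k \<longleftrightarrow> \<Psi> (cluster S k) / cluster T k \<in> Q"

lemma source_seedD:
  assumes "source_seed S"
  shows "cluster S j \<in> A" "cluster S j \<noteq> 0" "\<Psi> (cluster S j) \<noteq> 0"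
    "pplus S j \<in> A" "pplus S j \<noteq> 0" "\<Psi> (pplus S j) \<in> Q" "\<Psi> (pplus S j) \<noteq> 0"
    "pminus S j \<in> A" "pminus S j \<noteq> 0" "\<Psi> (pminus S j) \<in> Q" "\<Psi> (pminus S j) \<noteq> 0"
    "skew_symmetrizable (exmat S)"
proof -
  have S: "nn_seed P S" using assms by (simp add: source_seed_def)
  note nn = nn_seedD[OF P S]
  show x: "cluster S j \<in> A" "cluster S j \<noteq> 0"
    and p: "pplus S j \<in> A" "pplus S j \<noteq> 0" "\<Psi> (pplus S j) \<in> Q"
    and m: "pminus S j \<in> A" "pminus S j \<noteq> 0" "\<Psi> (pminus S j) \<in> Q"
    and "skew_symmetrizable (exmat S)"
    using assms nn P_le hom_P by (auto simp: source_seed_def)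
  show "\<Psi> (cluster S j) \<noteq> 0" "\<Psi> (pplus S j) \<noteq> 0" "\<Psi> (pminus S j) \<noteq> 0"
    using hom_divide(2)[OF one] x p m by auto
qed

lemma hom_yhat:
  assumes S: "source_seed S"
  shows "yhat S j \<in> A" "yhat S j \<noteq> 0"
    "\<Psi> (yhat S j) = \<Psi> (pplus S j) / \<Psi> (pminus S j) * (\<Prod>i\<in>UNIV. \<Psi> (cluster S i) powi (exmat S $ i $ j))"
proof -
  note S = source_seedD[OF S]
  have prod: "(\<Prod>i\<in>UNIV. cluster S i powi (exmat S $ i $ j)) \<in> A"
    "\<Psi> (\<Prod>i\<in>UNIV. cluster S i powi (exmat S $ i $ j)) = (\<Prod>i\<in>UNIV. \<Psi> (cluster S i) powi (exmat S $ i $ j))"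
    using hom_prod[of UNIV "\<lambda>i. cluster S i powi (exmat S $ i $ j)"] hom_powi S by auto
  show "yhat S j \<in> A" "\<Psi> (yhat S j) = \<Psi> (pplus S j) / \<Psi> (pminus S j) *
      (\<Prod>i\<in>UNIV. \<Psi> (cluster S i) powi (exmat S $ i $ j))"
    unfolding yhat_def using prod S by (auto simp: mult hom_mult divide hom_divide)
  show "yhat S j \<noteq> 0"
    unfolding yhat_def using S by simp
qed

text \<open>For \<open>j\<close> other than \<open>k\<close>, mutation alters column
  \<open>j\<close> and its \<open>yhat\<close> only by means of the entry in row \<open>k\<close>,
  column \<open>k\<close> and \<open>yhat\<close> at \<open>k\<close>. If that entry is zero nothing
  changes; otherwise agreement at \<open>k\<close> makes both changes correspond.\<close>

lemma matching_mutation: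
  assumes S: "source_seed S" "source_seed S'" and T: "nn_seed Q T" "nn_seed Q T'"
    and mut: "mutation k S S'" "mutation k T T'"
    and j: "matching S T j" and k: "j = k \<or> exmat S $ k $ j = 0 \<or> matching S T k"
  shows "matching S' T' j"
proof -
  note s = source_seedD[OF S(1)] and s' = source_seedD[OF S(2)] and y = hom_yhat(1,2)[OF S(1)]
  note t = nn_seedD[OF Q T(1)] and t' = nn_seedD[OF Q T(2)]
  have col: "exmat S $ i $ j = exmat T $ i $ j" for i
    using j by (auto simp: matching_def)
  have yj: "\<Psi> (yhat S j) = yhat T j"
    using j by (auto simp: matching_def)
  show ?thesis
  proof (cases "j = k")
    case True
    have "\<Psi> (yhat S' k) = inverse (\<Psi> (yhat S k))"
      unfolding yhat_mutation_self[OF mut(1) s(12)]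
      using hom_divide(1)[OF one y(1,2)] by (simp add: hom_one field_simps)
    then show ?thesis
      using True col yj mutationD(1)[OF mut(1)] mutationD(1)[OF mut(2)]
      by (simp add: matching_def yhat_mutation_self[OF mut(2) t(6)])
  next
    case False
    note yS = yhat_mutation_other[OF mut(1) s(12) s(2) s'(2) s(5) s(9) False]
    note yT = yhat_mutation_other[OF mut(2) t(6) t(5) t'(5) t(3) t(4) False]
    have mat: "exmat S' $ i $ j = exmat T' $ i $ j" for i
    proof (cases "i = k")
      case True
      then show ?thesis using col mutationD(1)[OF mut(1)] mutationD(1)[OF mut(2)] by simp
    next
      case ik: False
      then show ?thesis
        unfolding mutationD(2)[OF mut(1) ik False] mutationD(2)[OF mut(2) ik False]
        using col k False by (auto simp: matching_def pos_part_def)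
    qed
    show ?thesis
    proof (cases "exmat S $ k $ j = 0")
      case True
      then show ?thesis
        using yS yT mat col[of k] yj by (simp add: matching_def)
    next
      case b: False
      then have yk: "\<Psi> (yhat S k) = yhat T k"
        using k False by (auto simp: matching_def)
      define u where "u = (if exmat S $ k $ j \<ge> 0 then yhat S k else 1)"
      have u: "u \<in> A" "u \<noteq> 0" "\<Psi> u = (if exmat S $ k $ j \<ge> 0 then yhat T k else 1)"
        using y one hom_one yk by (auto simp: u_def)
      have v: "1 + yhat S k \<in> A" "1 + yhat S k \<noteq> 0" "\<Psi> (1 + yhat S k) = 1 + yhat T k"
        using one_plus_yhat_nonzero[OF mut(1) s(2) s'(2) s(9)]
        by (simp_all add: add one y hom_add hom_one yk)
      have "\<Psi> (yhat S' j) = yhat T j * (\<Psi> u / \<Psi> (1 + yhat S k)) powi (exmat S $ k $ j)"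
        unfolding yS u_def[symmetric]
        using u v y by (simp add: hom_mult hom_powi divide hom_divide yj)
      also have "\<dots> = yhat T' j"
        unfolding yT u(3) v(3) col[of k] ..
      finally show ?thesis
        using mat by (simp add: matching_def)
    qed
  qed
qed

text \<open>Only label \<open>k\<close> is affected. There \<Psi> is applied to the factored
  exchange relation: the factors \<open>1 + yhat\<close> correspond, and what remains is a quotient
  of coefficients.\<close>

lemma proportional_mutation:
  assumes S: "source_seed S" "source_seed S'" and T: "nn_seed Q T" "nn_seed Q T'"
    and mut: "mutation k S S'" "mutation k T T'"
    and k: "matching S T k" and ratio: "\<And>i. proportional S T i"
  shows "proportional S' T' j"
proof (cases "j = k")
  case False
  then show ?thesis
    using ratio[of j] mutationD(7)[OF mut(1) False] mutationD(7)[OF mut(2) False]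
    by (simp add: proportional_def)
next
  case True
  note s = source_seedD[OF S(1)] and s' = source_seedD[OF S(2)] and y = hom_yhat(1,2)[OF S(1)]
  note t = nn_seedD[OF Q T(1)] and t' = nn_seedD[OF Q T(2)]
  define e where "e i = pos_part (- (exmat S $ i $ k))" for i
  have e: "pos_part (- (exmat T $ i $ k)) = e i" for i
    using k by (auto simp: matching_def e_def)
  have yk: "\<Psi> (yhat S k) = yhat T k"
    using k by (auto simp: matching_def)
  define c where "c i = \<Psi> (cluster S i) / cluster T i" for i
  have c: "c i \<in> Q" "\<Psi> (cluster S i) = c i * cluster T i" for i
    using ratio[of i] t(5)[of i] by (auto simp: c_def proportional_def)
  have prod: "(\<Prod>i\<in>UNIV. cluster S i powi e i) \<in> A"
    "\<Psi> (\<Prod>i\<in>UNIV. cluster S i powi e i) = (\<Prod>i\<in>UNIV. (c i * cluster T i) powi e i)"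
    using hom_prod[of UNIV "\<lambda>i. cluster S i powi e i"] hom_powi s by (auto simp flip: c(2))
  have "\<Psi> (cluster S k) * \<Psi> (cluster S' k) = \<Psi> (cluster S k * cluster S' k)"
    using s s' by (simp add: hom_mult)
  also have "\<dots> = \<Psi> (pminus S k) * ((\<Prod>i\<in>UNIV. c i powi e i) * (\<Prod>i\<in>UNIV. cluster T i powi e i)) * (1 + yhat T k)"
    unfolding exchange_yhat[OF mut(1) s(2) s(9)] e_def[symmetric] prod_mult_powi[symmetric]
    using s prod y by (simp add: hom_mult mult hom_add add one hom_one yk)
  also have "\<dots> = \<Psi> (pminus S k) / pminus T k * (\<Prod>i\<in>UNIV. c i powi e i) * (cluster T k * cluster T' k)"
    unfolding exchange_yhat[OF mut(2) t(5) t(4)] e using t by simp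
  finally have "\<Psi> (cluster S' k) / cluster T' k =
      \<Psi> (pminus S k) / pminus T k * (\<Prod>i\<in>UNIV. c i powi e i) / c k"
    using s(3)[of k] t(4,5)[of k] t'(5)[of k] c(2)[of k] by (auto simp: field_simps)
  also have "\<dots> \<in> Q"
    using s(10) t(2) c(1) by (intro coefficient_groupD[OF Q] coefficient_group_prod[OF Q] coefficient_group_powi[OF Q])
  finally show ?thesis
    using True by (simp add: proportional_def)
qed

text \<open>The two exchange relations express one element as a sum of two monomials in the cluster
  of \<open>T\<close>. The summands agree either in the given order or after a swap, and the swap is
  the case of the opposite seed.\<close>

lemma exchange_matching:
  assumes S: "source_seed S" "source_seed S'" and T: "nn_seed Q T" "nn_seed Q T'"
    and mut: "mutation k S S'" "mutation k T T'"
    and ratio: "\<And>i. proportional S T i" "proportional S' T' k"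
  shows "matching S T k \<or> matching S (opp_seed T) k"
proof -
  note s = source_seedD[OF S(1)] and s' = source_seedD[OF S(2)]
  note t = nn_seedD[OF Q T(1)] and t' = nn_seedD[OF Q T(2)]
  define c where "c i = \<Psi> (cluster S i) / cluster T i" for i
  have c: "c i \<in> Q" "\<Psi> (cluster S i) = c i * cluster T i" "c i \<noteq> 0" for i
    using ratio(1)[of i] t(5)[of i] s(3)[of i] by (auto simp: c_def proportional_def)
  define c' where "c' = \<Psi> (cluster S' k) / cluster T' k"
  have c': "c' \<in> Q" "\<Psi> (cluster S' k) = c' * cluster T' k" "c' \<noteq> 0"
    using ratio(2) t'(5)[of k] s'(3)[of k] by (auto simp: c'_def proportional_def)
  have prod: "(\<Prod>i\<in>UNIV. cluster S i powi e i) \<in> A"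
    "\<Psi> (\<Prod>i\<in>UNIV. cluster S i powi e i) = (\<Prod>i\<in>UNIV. c i powi e i) * (\<Prod>i\<in>UNIV. cluster T i powi e i)" for e
    using hom_prod[of UNIV "\<lambda>i. cluster S i powi e i"] hom_powi s
    by (auto simp: c(2) simp flip: prod_mult_powi)
  define b where "b i = exmat S $ i $ k" for i
  define b' where "b' i = exmat T $ i $ k" for i
  \<comment> \<open>The scalars relating the two clusters are absorbed into the coefficients:
    \<open>q1\<close> and \<open>q2\<close> on the source side, \<open>r\<close> for the product of
    the old and the new variable.\<close>
  define q1 where "q1 = \<Psi> (pplus S k) * (\<Prod>i\<in>UNIV. c i powi pos_part (b i))"
  define q2 where "q2 = \<Psi> (pminus S k) * (\<Prod>i\<in>UNIV. c i powi pos_part (- b i))"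
  define r where "r = c k * c'"
  have inQ: "q1 \<in> Q" "q2 \<in> Q" "r * pplus T k \<in> Q" "r * pminus T k \<in> Q"
    unfolding q1_def q2_def r_def using s c(1) c'(1) t
    by (auto intro!: coefficient_groupD(3)[OF Q] coefficient_group_prod[OF Q] coefficient_group_powi[OF Q])
  have "q1 * (\<Prod>i\<in>UNIV. cluster T i powi pos_part (b i)) + q2 * (\<Prod>i\<in>UNIV. cluster T i powi pos_part (- b i)) =
      \<Psi> (cluster S k * cluster S' k)"
    unfolding mutationD(8)[OF mut(1)] q1_def q2_def b_def
    using s by (simp add: prod hom_mult hom_add mult)
  also have "\<dots> = r * (cluster T k * cluster T' k)"
    using s s' c(2) c'(2) by (simp add: hom_mult r_def)
  also have "\<dots> = r * pplus T k * (\<Prod>i\<in>UNIV. cluster T i powi pos_part (b' i)) +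
      r * pminus T k * (\<Prod>i\<in>UNIV. cluster T i powi pos_part (- b' i))"
    unfolding mutationD(8)[OF mut(2)] b'_def by (simp add: distrib_left)
  finally have cases:
    "q1 = r * pplus T k \<and> (\<lambda>i. nat (pos_part (b i))) = (\<lambda>i. nat (pos_part (b' i))) \<and>
     q2 = r * pminus T k \<and> (\<lambda>i. nat (pos_part (- b i))) = (\<lambda>i. nat (pos_part (- b' i))) \<or>
     q1 = r * pminus T k \<and> (\<lambda>i. nat (pos_part (b i))) = (\<lambda>i. nat (pos_part (- b' i))) \<and>
     q2 = r * pplus T k \<and> (\<lambda>i. nat (pos_part (- b i))) = (\<lambda>i. nat (pos_part (b' i)))"
    unfolding prod_powi_eq_monomial by (rule two_monomials_eq[OF Q t(7) inQ])
  \<comment> \<open>The exponents of the two monomials are the positive and negative parts of a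
    column, which together determine it.\<close>
  have pos_eq: "f i = g i"
    if "(\<lambda>i. nat (pos_part (f i))) = (\<lambda>i. nat (pos_part (g i)))"
      "(\<lambda>i. nat (pos_part (- f i))) = (\<lambda>i. nat (pos_part (- g i)))" for f g :: "'n \<Rightarrow> int" and i
    using fun_cong[OF that(1), of i] fun_cong[OF that(2), of i] pos_part_eq_iff[of "f i" "g i"]
    by (simp add: eq_nat_nat_iff)
  have r: "r \<noteq> 0" using c(3) c'(3) by (simp add: r_def)
  have yS: "\<Psi> (yhat S k) = q1 / q2 * (\<Prod>i\<in>UNIV. cluster T i powi b i)"
    unfolding hom_yhat[OF S(1)] c(2) prod_mult_powi q1_def q2_def
    using prod_powi_pos_part[of c b] c(3) by (simp add: b_def)
  from cases show ?thesis
  proof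
    assume *: "q1 = r * pplus T k \<and> (\<lambda>i. nat (pos_part (b i))) = (\<lambda>i. nat (pos_part (b' i))) \<and>
     q2 = r * pminus T k \<and> (\<lambda>i. nat (pos_part (- b i))) = (\<lambda>i. nat (pos_part (- b' i)))"
    then have "b i = b' i" for i by (intro pos_eq) auto
    then have "matching S T k"
      using * r by (simp add: matching_def b_def b'_def yS yhat_def[of T])
    then show ?thesis ..
  next
    assume *: "q1 = r * pminus T k \<and> (\<lambda>i. nat (pos_part (b i))) = (\<lambda>i. nat (pos_part (- b' i))) \<and>
     q2 = r * pplus T k \<and> (\<lambda>i. nat (pos_part (- b i))) = (\<lambda>i. nat (pos_part (b' i)))"
    then have "b i = - b' i" for i by (intro pos_eq[of b "\<lambda>i. - b' i"]) auto
    then have "matching S (opp_seed T) k"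
      using * r by (simp add: matching_def b_def b'_def yS yhat_def[of "opp_seed T"])
    then show ?thesis ..
  qed
qed

text \<open>The entries at \<open>(k, i)\<close> of the two matrices agree, while those at
  \<open>(i, k)\<close> are negatives of each other. Skew-symmetry of signs in both matrices permits
  this only for zero.\<close>

lemma matching_opp_imp_zero:
  assumes "source_seed S" "nn_seed Q T"
    and "matching S T i" "matching S (opp_seed T) k"
  shows "exmat S $ i $ k = 0"
proof -
  have "exmat S $ k $ i = exmat T $ k $ i" "exmat S $ i $ k = - exmat T $ i $ k"
    using assms(3,4) by (auto simp: matching_def)
  then show ?thesis
    using skew_symmetrizableD(2-4)[OF source_seedD(12)[OF assms(1)], of i k]
      skew_symmetrizableD(2-4)[OF nn_seedD(6)[OF Q assms(2)], of i k]
    by linarith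
qed

text \<open>The scalars \<open>c\<close> come from proportionality of the clusters. The equation for
  \<open>pplus\<close> then determines \<open>d\<close>, and the one for \<open>pminus\<close>
  amounts to equality of the \<open>yhat\<close>.\<close>

lemma seed_orbit_equiv_image:
  assumes S: "source_seed S" and T: "nn_seed Q T"
    and match: "\<And>k. matching S T k" and ratio: "\<And>k. proportional S T k"
  shows "seed_orbit_equiv Q (image_seed \<Psi> S) T"
proof -
  note s = source_seedD[OF S] and t = nn_seedD[OF Q T]
  define c where "c i = \<Psi> (cluster S i) / cluster T i" for i
  have c: "c i \<in> Q" "\<Psi> (cluster S i) = c i * cluster T i" "c i \<noteq> 0" for i
    using ratio[of i] t(5)[of i] s(3)[of i] by (auto simp: c_def proportional_def)
  define e where "e j = (\<Prod>i\<in>UNIV. c i powi pos_part (exmat S $ i $ j))" for j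
  define d where "d j = \<Psi> (pplus S j) / pplus T j * e j" for j
  have e: "e j \<in> Q" for j
    unfolding e_def using c(1) by (intro coefficient_group_prod[OF Q] coefficient_group_powi[OF Q])
  then have e0: "e j \<noteq> 0" for j using coefficient_groupD(1)[OF Q] by metis
  have d: "d j \<in> Q" for j
    unfolding d_def using s t e by (intro coefficient_groupD[OF Q])
  have minus: "pminus T j = \<Psi> (pminus S j) / d j * (\<Prod>i\<in>UNIV. c i powi pos_part (- (exmat S $ i $ j)))" for j
  proof -
    define f where "f = (\<Prod>i\<in>UNIV. c i powi pos_part (- (exmat S $ i $ j)))"
    define g where "g = (\<Prod>i\<in>UNIV. c i powi (exmat S $ i $ j))"
    define h where "h = (\<Prod>i\<in>UNIV. cluster T i powi (exmat S $ i $ j))"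
    have efg: "e j = f * g"
      unfolding e_def f_def g_def by (rule prod_powi_pos_part) (rule c)
    \<comment> \<open>The monomial \<open>h\<close> in the target cluster cancels, leaving an
      identity between coefficients.\<close>
    have "h \<noteq> 0" using t by (simp add: h_def)
    moreover have "\<Psi> (pplus S j) / \<Psi> (pminus S j) * (g * h) = pplus T j / pminus T j * h"
      using match[of j] unfolding matching_def hom_yhat(3)[OF S] c(2) prod_mult_powi
      by (auto simp: g_def h_def yhat_def)
    ultimately have "\<Psi> (pplus S j) * g * pminus T j = pplus T j * \<Psi> (pminus S j)"
      using s t by (simp add: field_simps)
    then show ?thesis
      using s t e0[of j] unfolding d_def f_def[symmetric] efg by (simp add: field_simps)
  qed
  have "exmat S = exmat T"
    using match by (simp add: matching_def vec_eq_iff)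
  moreover have "cluster T j = \<Psi> (cluster S j) / c j" for j
    using c by simp
  moreover have "pplus T j = \<Psi> (pplus S j) / d j * e j" for j
    using s t e0 by (simp add: d_def)
  ultimately show ?thesis
    unfolding seed_orbit_equiv_def image_seed_def e_def
    using c(1) d minus by (intro conjI exI[of _ c] exI[of _ d]) simp_all
qed

end


section \<open>Propagation along the nerve and the tree\<close>

lemma labeled_isoD:
  assumes "labeled_iso T T' \<phi>"
  shows "t \<in> lverts T \<Longrightarrow> \<phi> t \<in> lverts T'"
    "lgraph T \<Longrightarrow> (t, k, t') \<in> ledges T \<Longrightarrow> (\<phi> t, k, \<phi> t') \<in> ledges T'"
  using assms unfolding labeled_iso_def lgraph_def bij_betw_def by blast+

text \<open>The ambient semifield is a union over vertices; closure under the operations comes from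
  its description by a single cluster.\<close>

lemma seed_pattern_positive_hom:
  assumes E: "seed_pattern E" and Q: "coefficient_group Q"
    and hom: "semifield_hom (ambient_semifield E) A' \<Psi>" "\<Psi> ` coeffs E \<subseteq> Q"
  shows "positive_hom (coeffs E) (ambient_semifield E) Q \<Psi>"
    and "t \<in> lverts (tree E) \<Longrightarrow>
      positive_hom.source_seed (coeffs E) (ambient_semifield E) (seed_at E t)"
proof -
  have amb: "ambient_semifield E = subtraction_free (coeffs E) (cluster (seed_at E t))"
    if "t \<in> lverts (tree E)" for t
    using ambient_semifield_eq[OF E that] .
  obtain t0 where t0: "t0 \<in> lverts (tree E)"
    using seed_patternD(3)[OF E] by (auto simp: lconnected_def)
  show pos: "positive_hom (coeffs E) (ambient_semifield E) Q \<Psi>"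
    using seed_patternD(1)[OF E] Q hom
    by unfold_locales (auto simp: semifield_hom_def amb[OF t0] intro: subtraction_free.intros)
  show "positive_hom.source_seed (coeffs E) (ambient_semifield E) (seed_at E t)"
    if "t \<in> lverts (tree E)"
    unfolding positive_hom.source_seed_def[OF pos]
    using seed_patternD(4)[OF E that] amb[OF that] subtraction_free.var by auto
qed

text \<open>Agreement at every label with one common sign is preserved by each mutation, together
  with proportionality. The target pattern is arbitrary, so it may also be an opposite
  pattern.\<close>

lemma quasi_hom_propagate:
  assumes E: "seed_pattern E" and E': "seed_pattern E'"
    and iso: "labeled_iso (tree E) (tree E') \<phi>"
    and hom: "semifield_hom (ambient_semifield E) (ambient_semifield E') \<Psi>" "\<Psi> ` coeffs E \<subseteq> coeffs E'"
    and t0: "t0 \<in> lverts (tree E)"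
      "\<And>k. positive_hom.matching \<Psi> (seed_at E t0) (seed_at E' (\<phi> t0)) k"
      "\<And>k. positive_hom.proportional (coeffs E') \<Psi> (seed_at E t0) (seed_at E' (\<phi> t0)) k"
  shows "quasi_hom E E' \<phi> \<Psi>"
proof -
  note e = seed_patternD[OF E] and e' = seed_patternD[OF E'] and iso = labeled_isoD[OF iso]
  interpret positive_hom "coeffs E" "ambient_semifield E" "coeffs E'" \<Psi>
    by (rule seed_pattern_positive_hom(1)[OF E e'(1) hom])
  note src = seed_pattern_positive_hom(2)[OF E e'(1) hom]
  define R where "R t \<longleftrightarrow> (\<forall>k. matching (seed_at E t) (seed_at E' (\<phi> t)) k \<and>
    proportional (seed_at E t) (seed_at E' (\<phi> t)) k)" for t
  have "R t" if "t \<in> lverts (tree E)" for t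
  proof (rule lconnected_propagate[OF e(2,3) t0(1) _ that])
    show "R t0" using t0 by (simp add: R_def)
    fix s k u assume edge: "(s, k, u) \<in> ledges (tree E)" and s: "R s"
    have edge': "(\<phi> s, k, \<phi> u) \<in> ledges (tree E')" by (rule iso(2)[OF e(2) edge])
    show "R u"
      using s matching_mutation[OF src src e'(4) e'(4) e(5)[OF edge] e'(5)[OF edge']]
        proportional_mutation[OF src src e'(4) e'(4) e(5)[OF edge] e'(5)[OF edge']]
        e(6)[OF edge] e'(6)[OF edge']
      unfolding R_def by blast
  qed
  then show ?thesis
    unfolding quasi_hom_def R_def
    using hom seed_orbit_equiv_image[OF src e'(4)] iso(1) by blast
qed

text \<open>Label \<open>j\<close> occurs on some edge of the nerve, which gives a starting vertex.
  Edges with another label preserve the property.\<close>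

lemma nerve_proportional:
  assumes N: "lgraph N" "lconnected N" "\<And>k. \<exists>u v. (u, k, v) \<in> ledges N"
    and fixed: "\<And>s k t j. (s, k, t) \<in> ledges N \<Longrightarrow> j \<noteq> k \<Longrightarrow> R s j \<Longrightarrow> R t j"
    and edge: "\<And>t k t'. (t, k, t') \<in> ledges N \<Longrightarrow> R t k"
    and t: "t \<in> lverts N"
  shows "R t j"
proof -
  obtain u v where uv: "(u, j, v) \<in> ledges N" using N(3) by blast
  show ?thesis
  proof (rule lconnected_propagate[OF N(1,2) _ _ t, where R = "\<lambda>t. R t j"])
    show "u \<in> lverts N" using uv N(1) by (auto simp: lgraph_def)
    show "R u j" by (rule edge[OF uv])
    \<comment> \<open>For \<open>k = j\<close> the reversed edge gives the property at
      \<open>t\<close> outright.\<close>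
    show "R t j" if "(s, k, t) \<in> ledges N" "R s j" for s k t
      using that fixed edge N(1) unfolding lgraph_def by metis
  qed
qed

theorem proposition5p2:
  fixes E :: "('v, 'f::field_char_0, 'n::finite) pattern"
    and E' :: "('w, 'g::field_char_0, 'n) pattern"
    and \<phi> :: "'v \<Rightarrow> 'w"
    and N :: "('v, 'n) lgraph"
    and \<Psi> :: "'f \<Rightarrow> 'g"
  assumes "seed_pattern E"
    and "seed_pattern E'"
    and "labeled_iso (tree E) (tree E') \<phi>"
    and "\<forall>t\<in>lverts (tree E'). indecomposable (seed_at E' t)"
    and "nerve N (tree E)"
    and "semifield_hom (ambient_semifield E) (ambient_semifield E') \<Psi>"
    and "\<Psi> ` coeffs E \<subseteq> coeffs E'"
    and "\<forall>t j t'. (t, j, t') \<in> ledges N \<longrightarrow>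
           \<Psi> (cluster (seed_at E t) j) / cluster (seed_at E' (\<phi> t)) j \<in> coeffs E'"
  shows "quasi_hom E E' \<phi> \<Psi> \<or> quasi_hom E (opp_pattern E') \<phi> \<Psi>"
proof -
  note e = seed_patternD[OF assms(1)] and e' = seed_patternD[OF assms(2)]
    and iso = labeled_isoD[OF assms(3)]
  interpret positive_hom "coeffs E" "ambient_semifield E" "coeffs E'" \<Psi>
    by (rule seed_pattern_positive_hom(1)[OF assms(1) e'(1) assms(6,7)])
  note src = seed_pattern_positive_hom(2)[OF assms(1) e'(1) assms(6,7)]
  have N: "lgraph N" "lconnected N" "lverts N \<subseteq> lverts (tree E)" "ledges N \<subseteq> ledges (tree E)"
    "\<And>k. \<exists>u v. (u, k, v) \<in> ledges N"
    using assms(5) by (auto simp: nerve_def)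
  have iso_edge: "(\<phi> s, k, \<phi> t) \<in> ledges (tree E')" if "(s, k, t) \<in> ledges N" for s k t
    using iso(2)[OF e(2)] that N(4) by blast
  \<comment> \<open>The Boolean encodes the sign: \<open>True\<close> compares with
    \<open>E'\<close>, \<open>False\<close> with its opposite.\<close>
  define T where "T b t = (if b then seed_at E' (\<phi> t) else opp_seed (seed_at E' (\<phi> t)))" for b t
  have T: "nn_seed (coeffs E') (T b t)" if "t \<in> lverts (tree E)" for b t
    using e'(4)[OF iso(1)[OF that]] by (simp add: T_def nn_seed_opp)
  have T_mut: "mutation k (T b s) (T b t)" if "(s, k, t) \<in> ledges N" for b s k t
    using e'(5)[OF iso_edge[OF that]] by (simp add: T_def mutation_opp)
  have mut: "mutation k (seed_at E s) (seed_at E t)" and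
    verts: "s \<in> lverts (tree E)" "t \<in> lverts (tree E)" if "(s, k, t) \<in> ledges N" for s k t
    using e(5,6) N(4) that by blast+

  \<comment> \<open>Opposite seeds share their clusters, so proportionality holds for both values of
    \<open>b\<close>.\<close>
  have ratio: "proportional (seed_at E t) (T b t) j" if "t \<in> lverts N" for b t j
    using N(1,2,5) _ _ that
  proof (rule nerve_proportional[where R = "\<lambda>t j. proportional (seed_at E t) (T b t) j"])
    show "proportional (seed_at E t) (T b t) k" if "(t, k, t') \<in> ledges N" for t k t'
      using assms(8) that by (auto simp: proportional_def T_def)
    show "proportional (seed_at E t) (T b t) j"
      if "(s, k, t) \<in> ledges N" "j \<noteq> k" "proportional (seed_at E s) (T b s) j" for s k t j
      using that(3) mutationD(7)[OF mut[OF that(1)] that(2)] mutationD(7)[OF T_mut[OF that(1)] that(2)]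
      by (simp add: proportional_def)
  qed

  \<comment> \<open>The sign attached to each label\<close>
  have edge_match: "\<exists>b. matching (seed_at E s) (T b s) k" if edge: "(s, k, t) \<in> ledges N" for s k t
  proof -
    have "s \<in> lverts N" "t \<in> lverts N" using N(1) edge by (auto simp: lgraph_def)
    then have "matching (seed_at E s) (T True s) k \<or> matching (seed_at E s) (opp_seed (T True s)) k"
      by (intro exchange_matching[OF src src T T mut T_mut, OF _ _ _ _ edge edge] verts[OF edge] ratio)
    then show ?thesis by (auto simp: T_def intro: exI[of _ True] exI[of _ False])
  qed

  have signs: "exmat (seed_at E t) $ i $ k = 0"
    if "matching (seed_at E t) (T b t) i" "matching (seed_at E t) (T b' t) k" "b \<noteq> b'"
      "t \<in> lverts (tree E)" for b b' t i k
    using matching_opp_imp_zero[OF src[OF that(4)] T[OF that(4)] that(1)] that(2,3)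
    by (cases b; cases b') (auto simp: T_def)

  \<comment> \<open>The sign of \<open>k\<close> is read off at one edge labeled \<open>k\<close>
    and then carried through the nerve, where each direction crossed has a sign of its own.\<close>
  have "\<exists>b. \<forall>t\<in>lverts N. matching (seed_at E t) (T b t) k" for k
  proof -
    obtain u v where uv: "(u, k, v) \<in> ledges N" using N(5) by blast
    obtain b where b: "matching (seed_at E u) (T b u) k" using edge_match[OF uv] by blast
    have "matching (seed_at E t) (T b t) k" if "t \<in> lverts N" for t
    proof (rule lconnected_propagate[OF N(1,2) _ _ that, where R = "\<lambda>t. matching (seed_at E t) (T b t) k"])
      show "u \<in> lverts N" using uv N(1) by (auto simp: lgraph_def)
      show "matching (seed_at E u) (T b u) k" by (rule b)
      fix s i t assume edge: "(s, i, t) \<in> ledges N" and s: "matching (seed_at E s) (T b s) k"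
      obtain b' where b': "matching (seed_at E s) (T b' s) i" using edge_match[OF edge] by blast
      \<comment> \<open>If the signs of \<open>i\<close> and \<open>k\<close> at \<open>s\<close>
        differ, the entry between them vanishes; if they agree, the last alternative holds.\<close>
      have "k = i \<or> exmat (seed_at E s) $ i $ k = 0 \<or> matching (seed_at E s) (T b s) i"
        using signs[OF b' s] b' verts[OF edge] by (cases "b = b'") auto
      then show "matching (seed_at E t) (T b t) k"
        by (intro matching_mutation[OF src src T T mut T_mut, OF _ _ _ _ edge edge] verts[OF edge] s)
    qed
    then show ?thesis by blast
  qed
  then obtain \<epsilon> where \<epsilon>: "\<And>k t. t \<in> lverts N \<Longrightarrow> matching (seed_at E t) (T (\<epsilon> k) t) k"
    by metis

  \<comment> \<open>Equality of all signs\<close>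
  obtain t0 where t0N: "t0 \<in> lverts N" using N(2) by (auto simp: lconnected_def)
  then have t0: "t0 \<in> lverts (tree E)" using N(3) by blast
  define B where "B = exmat (seed_at E' (\<phi> t0))"
  \<comment> \<open>Indecomposability concerns the target matrix, so the zeros found in the source
    matrix are transferred to \<open>B\<close>, where they hold up to sign.\<close>
  have \<epsilon>_eq: "\<epsilon> i = \<epsilon> k" if "B $ i $ k \<noteq> 0 \<or> B $ k $ i \<noteq> 0" for i k
  proof (rule ccontr)
    assume ne: "\<epsilon> i \<noteq> \<epsilon> k"
    have "exmat (seed_at E t0) $ i $ k = 0" "exmat (seed_at E t0) $ k $ i = 0"
      using signs[OF \<epsilon> \<epsilon> _ t0, OF t0N t0N] ne by metis+
    then have "B $ i $ k = 0" "B $ k $ i = 0"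
      using \<epsilon>[OF t0N, of i] \<epsilon>[OF t0N, of k]
      by (auto simp: matching_def T_def B_def split: if_splits)
    then show False using that by simp
  qed
  have "indecomposable (seed_at E' (\<phi> t0))"
    using assms(4) iso(1)[OF t0] by blast
  then have conn: "(\<lambda>i k. B $ i $ k \<noteq> 0 \<or> B $ k $ i \<noteq> 0)\<^sup>*\<^sup>* i k" for i k
    by (simp add: indecomposable_def B_def)
  have \<epsilon>_const: "\<epsilon> i = \<epsilon> k" for i k
    using conn[of i k] by induction (simp_all add: \<epsilon>_eq)
  \<comment> \<open>Any label may be used here, as \<epsilon> is constant.\<close>
  define b where "b = \<epsilon> undefined"
  have match: "matching (seed_at E t0) (T b t0) k" for k
    using \<epsilon>[OF t0N, of k] \<epsilon>_const[of k undefined] by (simp add: b_def)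

  \<comment> \<open>Extension from one vertex to the whole tree\<close>
  show ?thesis
  proof (cases b)
    case True
    have "quasi_hom E E' \<phi> \<Psi>"
      using match ratio[OF t0N, of b] True
      by (intro quasi_hom_propagate[OF assms(1-3,6,7) t0]) (simp_all add: T_def)
    then show ?thesis ..
  next
    case False
    have "quasi_hom E (opp_pattern E') \<phi> \<Psi>"
      using match ratio[OF t0N, of b] False assms(3,6,7)
      by (intro quasi_hom_propagate[OF assms(1) seed_pattern_opp[OF assms(2)] _ _ _ t0]) (simp_all add: T_def)
    then show ?thesis ..
  qed
qed

end
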